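(* Let $\mathcal N$ be an nfa accepting the language $L$. 1. $\mathcal N$ is atomic iff the dfas $\mathbf{rsc}(\mathbf{rev}(\mathcal N))$ and $\mathbf{dfa}(L^r)$ are isomorphic. 2. $\mathcal N$ is positively atomic iff there is a dfa isomorphism as in (1) which is also an order isomorphism with respect to inclusion (of reachable subsets on one side, of left word quotients on the other). 3. $\mathcal N$ is subatomic iff the transition monoid of $\mathbf{rsc}(\mathbf{rev}(\mathcal N))$ is isomorphic to the syntactic monoid of $L^r$ via $$\lambda[\![w]\!]_{\mathbf{TM}(\mathbf{rsc}(\mathbf{rev}(\mathcal N)))}.\ [\![w]\!]_{\mathcal S_{L^r}}:\mathbf{TM}(\mathbf{rsc}(\mathbf{rev}(\mathcal N)))\to\mathbf{Syn}(L^r).$$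
   Context: Fix an alphabet $\Sigma$. An nfa is $\mathcal N=(I,Z,\mathcal N_a,F)$ with $Z$ a finite set, $I,F\subseteq Z$, $\mathcal N_a\subseteq Z\times Z$ for $a\in\Sigma$; $\mathcal N_\varepsilon=\mathrm{id}_Z$, $\mathcal N_{ua}=\mathcal N_u;\mathcal N_a$ (relational composition), $\mathcal N_w[X]$ is the image of $X$. It accepts $\{w:\mathcal N_w[I]\cap F\neq\emptyset\}$; for $z\in Z$, $z$ accepts the language accepted by $\mathcal N$ with initial states changed to $\{z\}$. $\mathbf{rev}(\mathcal N)=(F,Z,\breve{\mathcal N_a},I)$ (converse transitions). $\mathbf{rsc}(\mathcal N)$ is the reachable subset construction: the dfa with states $\{\mathcal N_w[I]:w\in\Sigma^*\}$, initial state $I$, transitions $X\mapsto\mathcal N_a[X]$, final states those $X$ with $X\cap F\neq\emptyset$. A dfa isomorphism is a bijection of states preserving the initial state, commuting with transitions, and preserving and reflecting final states. $L^r$ is the reversed language, $u^{-1}L=\{w:uw\in L\}$, $u^{-1}Lv^{-1}=\{w:uwv\in L\}$, $\mathsf{LW}(L)=\{u^{-1}L:u\in\Sigma^*\}$. $\mathbf{dfa}(L)$ is the dfa with states $\mathsf{LW}(L)$, initial state $L$, transitions $X\mapsto a^{-1}X$, final states $\{X:\varepsilon\in X\}$. $\mathsf{LP}(L)$ is the set of all set-theoretic boolean combinations (in $\mathcal P\Sigma^*$) of elements of $\mathsf{LW}(L)$. $\mathsf{LD}(L)$ is the closure of $\mathsf{LW}(L)$ under all unions and intersections (including the empty ones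 $\emptyset$ and $\Sigma^*$). $\mathsf{LRP}(L)$ is the closure of $\{u^{-1}Lv^{-1}:u,v\in\Sigma^*\}$ under the set-theoretic boolean operations. The nfa $\mathcal N$ accepting $L$ is atomic (resp. positively atomic, subatomic) if every state accepts a language in $\mathsf{LP}(L)$ (resp. $\mathsf{LD}(L)$, $\mathsf{LRP}(L)$). For a dfa $\delta$ with transition functions $\delta_a$, let $\delta_\varepsilon=\mathrm{id}$, $\delta_{ua}=\delta_a\circ\delta_u$. The transition monoid $\mathbf{TM}(\delta)$ has elements $[\![w]\!]_{\mathbf{TM}(\delta)}:=\delta_w$ ($w\in\Sigma^*$), unit $\mathrm{id}$, and multiplication composition in diagrammatic order, $\delta_u\cdot\delta_v:=\delta_v\circ\delta_u=\delta_{uv}$. The syntactic monoid is $\mathbf{Syn}(L)=\Sigma^*/\mathcal S_L$ with $\mathcal S_L(u,v)\iff\forall x,y.[xuy\in L\iff xvy\in L]$ and classes $[\![w]\!]_{\mathcal S_L}$. *)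

theory Defs
  imports "HOL-Algebra.Group"
begin

text \<open>The alphabet is the type \<open>'a\<close>, so words are lists and \<open>UNIV :: 'a list set\<close> is the set of all words.\<close>

record ('a, 'q) nfa =
  nfa_init :: "'q set"
  nfa_states :: "'q set"
  nfa_trans :: "'a \<Rightarrow> ('q \<times> 'q) set"
  nfa_final :: "'q set"

definition is_nfa :: "('a, 'q) nfa \<Rightarrow> bool" where
  "is_nfa N \<longleftrightarrow> finite (nfa_states N) \<and> nfa_init N \<subseteq> nfa_states N \<and> nfa_final N \<subseteq> nfa_states N
     \<and> (\<forall>a. nfa_trans N a \<subseteq> nfa_states N \<times> nfa_states N)"

definition nfa_rel :: "('a, 'q) nfa \<Rightarrow> 'a list \<Rightarrow> ('q \<times> 'q) set" where
  "nfa_rel N w = foldl (\<lambda>R a. R O nfa_trans N a) (Id_on (nfa_states N)) w"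

lemma nfa_rel_Nil: "nfa_rel N [] = Id_on (nfa_states N)"
  and nfa_rel_snoc: "nfa_rel N (u @ [a]) = nfa_rel N u O nfa_trans N a"
  by (simp_all add: nfa_rel_def)

definition nfa_lang :: "('a, 'q) nfa \<Rightarrow> 'a list set" where
  "nfa_lang N = {w. nfa_rel N w `` nfa_init N \<inter> nfa_final N \<noteq> {}}"

definition state_lang :: "('a, 'q) nfa \<Rightarrow> 'q \<Rightarrow> 'a list set" where
  "state_lang N z = nfa_lang (N\<lparr>nfa_init := {z}\<rparr>)"

definition nfa_rev :: "('a, 'q) nfa \<Rightarrow> ('a, 'q) nfa" where
  "nfa_rev N = \<lparr>nfa_init = nfa_final N, nfa_states = nfa_states N,
     nfa_trans = (\<lambda>a. (nfa_trans N a)\<inverse>), nfa_final = nfa_init N\<rparr>"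

lemma is_nfa_rev: "is_nfa N \<Longrightarrow> is_nfa (nfa_rev N)"
  by (auto simp: is_nfa_def nfa_rev_def)

text \<open>Only the values of the transition functions on the set of states are meaningful.\<close>

record ('a, 's) dfa =
  dfa_init :: 's
  dfa_states :: "'s set"
  dfa_trans :: "'a \<Rightarrow> 's \<Rightarrow> 's"
  dfa_final :: "'s set"

definition dfa_iso :: "('s \<Rightarrow> 't) \<Rightarrow> ('a, 's) dfa \<Rightarrow> ('a, 't) dfa \<Rightarrow> bool" where
  "dfa_iso f A B \<longleftrightarrow> bij_betw f (dfa_states A) (dfa_states B)
     \<and> f (dfa_init A) = dfa_init B
     \<and> (\<forall>a. \<forall>q\<in>dfa_states A. f (dfa_trans A a q) = dfa_trans B a (f q))
     \<and> (\<forall>q\<in>dfa_states A. q \<in> dfa_final A \<longleftrightarrow> f q \<in> dfa_final B)"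

definition rsc :: "('a, 'q) nfa \<Rightarrow> ('a, 'q set) dfa" where
  "rsc N = \<lparr>dfa_init = nfa_init N,
     dfa_states = {nfa_rel N w `` nfa_init N | w. True},
     dfa_trans = (\<lambda>a X. nfa_trans N a `` X),
     dfa_final = {nfa_rel N w `` nfa_init N | w. nfa_rel N w `` nfa_init N \<inter> nfa_final N \<noteq> {}}\<rparr>"

lemma rsc_init_closed: "is_nfa N \<Longrightarrow> dfa_init (rsc N) \<in> dfa_states (rsc N)"
proof -
  assume "is_nfa N"
  then have "nfa_init N = nfa_rel N [] `` nfa_init N"
    by (auto simp: is_nfa_def nfa_rel_Nil)
  then have "nfa_init N \<in> {nfa_rel N w `` nfa_init N | w. True}" by blast
  then show ?thesis by (simp add: rsc_def)
qed

lemma rsc_trans_closed: "X \<in> dfa_states (rsc N) \<Longrightarrow> dfa_trans (rsc N) a X \<in> dfa_states (rsc N)"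
proof -
  have "nfa_trans N a `` (nfa_rel N w `` nfa_init N) = nfa_rel N (w @ [a]) `` nfa_init N" for w
    by (simp add: nfa_rel_snoc relcomp_Image)
  then show "X \<in> dfa_states (rsc N) \<Longrightarrow> ?thesis" unfolding rsc_def by fastforce
qed

definition lang_rev :: "'a list set \<Rightarrow> 'a list set" where
  "lang_rev L = rev ` L"

definition lquot :: "'a list \<Rightarrow> 'a list set \<Rightarrow> 'a list set" where
  "lquot u L = {w. u @ w \<in> L}"

definition lrquot :: "'a list \<Rightarrow> 'a list set \<Rightarrow> 'a list \<Rightarrow> 'a list set" where
  "lrquot u L v = {w. u @ w @ v \<in> L}"

definition LW :: "'a list set \<Rightarrow> 'a list set set" where
  "LW L = {lquot u L | u. True}"

definition dfa_of :: "'a list set \<Rightarrow> ('a, 'a list set) dfa" where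
  "dfa_of L = \<lparr>dfa_init = L, dfa_states = LW L,
     dfa_trans = (\<lambda>a X. lquot [a] X), dfa_final = {X \<in> LW L. [] \<in> X}\<rparr>"

lemma dfa_of_init_closed: "dfa_init (dfa_of L) \<in> dfa_states (dfa_of L)"
proof -
  have "L = lquot [] L" by (simp add: lquot_def)
  then have "L \<in> LW L" unfolding LW_def by blast
  then show ?thesis by (simp add: dfa_of_def)
qed

lemma dfa_of_trans_closed: "X \<in> dfa_states (dfa_of L) \<Longrightarrow> dfa_trans (dfa_of L) a X \<in> dfa_states (dfa_of L)"
proof -
  have "lquot [a] (lquot u L) = lquot (u @ [a]) L" for u by (simp add: lquot_def)
  then show "X \<in> dfa_states (dfa_of L) \<Longrightarrow> ?thesis" by (auto simp: dfa_of_def LW_def)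
qed

inductive_set bool_closure :: "'b set set \<Rightarrow> 'b set set" for G where
  base: "X \<in> G \<Longrightarrow> X \<in> bool_closure G"
| empty: "{} \<in> bool_closure G"
| compl: "X \<in> bool_closure G \<Longrightarrow> - X \<in> bool_closure G"
| union: "X \<in> bool_closure G \<Longrightarrow> Y \<in> bool_closure G \<Longrightarrow> X \<union> Y \<in> bool_closure G"
| inter: "X \<in> bool_closure G \<Longrightarrow> Y \<in> bool_closure G \<Longrightarrow> X \<inter> Y \<in> bool_closure G"

text \<open>The instances \<open>S = {}\<close> below give the empty union \<open>{}\<close> and the empty intersection \<open>UNIV\<close>.\<close>

inductive_set lattice_closure :: "'b set set \<Rightarrow> 'b set set" for G where
  base: "X \<in> G \<Longrightarrow> X \<in> lattice_closure G"
| Union: "(\<And>X. X \<in> S \<Longrightarrow> X \<in> lattice_closure G) \<Longrightarrow> \<Union>S \<in> lattice_closure G"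
| Inter: "(\<And>X. X \<in> S \<Longrightarrow> X \<in> lattice_closure G) \<Longrightarrow> \<Inter>S \<in> lattice_closure G"

definition LP :: "'a list set \<Rightarrow> 'a list set set" where
  "LP L = bool_closure (LW L)"

definition LD :: "'a list set \<Rightarrow> 'a list set set" where
  "LD L = lattice_closure (LW L)"

definition LRP :: "'a list set \<Rightarrow> 'a list set set" where
  "LRP L = bool_closure {lrquot u L v | u v. True}"

definition nfa_atomic :: "('a, 'q) nfa \<Rightarrow> bool" where
  "nfa_atomic N \<longleftrightarrow> (\<forall>z\<in>nfa_states N. state_lang N z \<in> LP (nfa_lang N))"

definition nfa_positively_atomic :: "('a, 'q) nfa \<Rightarrow> bool" where
  "nfa_positively_atomic N \<longleftrightarrow> (\<forall>z\<in>nfa_states N. state_lang N z \<in> LD (nfa_lang N))"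

definition nfa_subatomic :: "('a, 'q) nfa \<Rightarrow> bool" where
  "nfa_subatomic N \<longleftrightarrow> (\<forall>z\<in>nfa_states N. state_lang N z \<in> LRP (nfa_lang N))"

text \<open>The maps \<open>dfa_act A w\<close> are made extensional on the set of states by \<open>restrict\<close> and
  \<open>compose\<close>, so that they are equal iff they agree on all states.\<close>

definition dfa_act :: "('a, 's) dfa \<Rightarrow> 'a list \<Rightarrow> 's \<Rightarrow> 's" where
  "dfa_act A w = foldl (\<lambda>f a. compose (dfa_states A) (dfa_trans A a) f)
     (restrict id (dfa_states A)) w"

lemma dfa_act_Nil: "dfa_act A [] = restrict id (dfa_states A)"
  and dfa_act_snoc: "dfa_act A (u @ [a]) = compose (dfa_states A) (dfa_trans A a) (dfa_act A u)"
  by (simp_all add: dfa_act_def)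

definition TM :: "('a, 's) dfa \<Rightarrow> ('s \<Rightarrow> 's) monoid" where
  "TM A = \<lparr>carrier = range (dfa_act A), mult = (\<lambda>f g. compose (dfa_states A) g f),
     one = restrict id (dfa_states A)\<rparr>"

lemma dfa_act_closed:
  assumes "\<And>a q. q \<in> dfa_states A \<Longrightarrow> dfa_trans A a q \<in> dfa_states A"
  shows "q \<in> dfa_states A \<Longrightarrow> dfa_act A w q \<in> dfa_states A"
  by (induction w rule: rev_induct) (auto simp: dfa_act_Nil dfa_act_snoc compose_def assms)

lemma TM_mult:
  assumes "\<And>a q. q \<in> dfa_states A \<Longrightarrow> dfa_trans A a q \<in> dfa_states A"
  shows "dfa_act A u \<otimes>\<^bsub>TM A\<^esub> dfa_act A v = dfa_act A (u @ v)"
proof (induction v rule: rev_induct)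
  case Nil
  have "dfa_act A u \<in> extensional (dfa_states A)"
    by (cases u rule: rev_cases) (auto simp: dfa_act_Nil dfa_act_snoc)
  then show ?case using dfa_act_closed[OF assms]
    by (auto simp: TM_def dfa_act_Nil compose_def fun_eq_iff extensional_def)
next
  case (snoc a v)
  have "dfa_act A u \<otimes>\<^bsub>TM A\<^esub> dfa_act A (v @ [a])
      = compose (dfa_states A) (dfa_trans A a) (dfa_act A u \<otimes>\<^bsub>TM A\<^esub> dfa_act A v)"
    using dfa_act_closed[OF assms] by (auto simp: TM_def dfa_act_snoc compose_def fun_eq_iff)
  then show ?case using snoc by (simp add: dfa_act_snoc flip: append_assoc)
qed

lemma monoid_TM:
  assumes "\<And>a q. q \<in> dfa_states A \<Longrightarrow> dfa_trans A a q \<in> dfa_states A"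
  shows "monoid (TM A)"
proof -
  note mult = TM_mult[OF assms]
  have c: "carrier (TM A) = range (dfa_act A)" and one: "\<one>\<^bsub>TM A\<^esub> = dfa_act A []"
    by (simp_all add: TM_def dfa_act_Nil)
  show ?thesis by (rule monoidI) (auto simp: c one mult)
qed

definition syn_cong :: "'a list set \<Rightarrow> ('a list \<times> 'a list) set" where
  "syn_cong L = {(u, v). \<forall>x y. x @ u @ y \<in> L \<longleftrightarrow> x @ v @ y \<in> L}"

definition syn_class :: "'a list set \<Rightarrow> 'a list \<Rightarrow> 'a list set" where
  "syn_class L w = syn_cong L `` {w}"

text \<open>The product of two classes is written as a union over representatives; it is the class
  of the concatenation of any two of them by \<open>Syn_mult\<close> below.\<close>

definition Syn :: "'a list set \<Rightarrow> 'a list set monoid" where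
  "Syn L = \<lparr>carrier = UNIV // syn_cong L,
     mult = (\<lambda>X Y. \<Union>u\<in>X. \<Union>v\<in>Y. syn_class L (u @ v)), one = syn_class L []\<rparr>"

lemma equiv_syn_cong: "equiv UNIV (syn_cong L)"
  by (rule equivI) (auto simp: syn_cong_def refl_on_def sym_def trans_def)

lemma syn_cong_append:
  assumes "(u, u') \<in> syn_cong L" "(v, v') \<in> syn_cong L"
  shows "(u @ v, u' @ v') \<in> syn_cong L"
proof -
  have "x @ u @ v @ y \<in> L \<longleftrightarrow> x @ u' @ v' @ y \<in> L" for x y
  proof -
    have "x @ u @ (v @ y) \<in> L \<longleftrightarrow> x @ u' @ (v @ y) \<in> L"
      using assms(1) unfolding syn_cong_def by blast
    moreover have "(x @ u') @ v @ y \<in> L \<longleftrightarrow> (x @ u') @ v' @ y \<in> L"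
      using assms(2) unfolding syn_cong_def by blast
    ultimately show ?thesis by simp
  qed
  then show ?thesis by (simp add: syn_cong_def)
qed

lemma Syn_mult: "syn_class L u \<otimes>\<^bsub>Syn L\<^esub> syn_class L v = syn_class L (u @ v)"
proof -
  have "syn_class L (u' @ v') = syn_class L (u @ v)"
    if "u' \<in> syn_class L u" "v' \<in> syn_class L v" for u' v'
    using that syn_cong_append[of u u' L v v'] equiv_class_eq[OF equiv_syn_cong]
    unfolding syn_class_def by blast
  moreover have "w \<in> syn_class L w" for w
    by (simp add: syn_class_def syn_cong_def)
  ultimately have "(\<Union>u'\<in>syn_class L u. \<Union>v'\<in>syn_class L v. syn_class L (u' @ v')) = syn_class L (u @ v)"
    by blast
  then show ?thesis by (simp add: Syn_def)
qed

lemma monoid_Syn: "monoid (Syn L)"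
proof -
  have c: "carrier (Syn L) = range (syn_class L)" and one: "\<one>\<^bsub>Syn L\<^esub> = syn_class L []"
    by (auto simp: Syn_def syn_class_def quotient_def)
  show ?thesis by (rule monoidI) (auto simp: c one Syn_mult)
qed

definition monoid_iso :: "('m \<Rightarrow> 'n) \<Rightarrow> 'm monoid \<Rightarrow> 'n monoid \<Rightarrow> bool" where
  "monoid_iso h G H \<longleftrightarrow> h \<in> iso G H \<and> h \<one>\<^bsub>G\<^esub> = \<one>\<^bsub>H\<^esub>"

end

theory Submission
  imports Defs
begin

text \<open>Let \<open>S x\<close> be the set of states of \<open>N\<close> accepting \<open>x\<close> and \<open>L = nfa_lang N\<close>. The state reached by
  \<open>rev x\<close> is \<open>S x\<close> in \<open>rsc (nfa_rev N)\<close> and \<open>{v. rev v @ x \<in> L}\<close> in \<open>dfa_of (lang_rev L)\<close>, and the second is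
  a monotone function of the first. So a dfa isomorphism exists iff \<open>S x\<close> is determined by the
  left quotients of \<open>L\<close> containing \<open>x\<close>, that is, iff the language of every state is saturated under
  the equivalence induced by \<open>LW L\<close>. As \<open>LW L\<close> is finite, saturated languages are exactly its
  boolean combinations. The ordered case replaces saturated languages by up-closed ones, and the
  case of the transition monoid replaces left quotients by two-sided quotients, whose induced
  equivalence is the syntactic congruence.\<close>

section \<open>Closures as saturated and up-closed sets\<close>

lemma bool_closure_Inter:
  "finite T \<Longrightarrow> T \<subseteq> bool_closure G \<Longrightarrow> \<Inter>T \<in> bool_closure G"
proof (induction T rule: finite_induct)
  case empty
  have "- {} \<in> bool_closure G" by (intro bool_closure.compl bool_closure.empty)
  then show ?case by simp
qed (auto intro: bool_closure.inter)

lemma bool_closure_Union: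
  "finite T \<Longrightarrow> T \<subseteq> bool_closure G \<Longrightarrow> \<Union>T \<in> bool_closure G"
  by (induction T rule: finite_induct) (auto intro: bool_closure.union bool_closure.empty)

lemma bool_closure_saturated:
  assumes "A \<in> bool_closure G" "\<And>X. X \<in> G \<Longrightarrow> x \<in> X \<longleftrightarrow> y \<in> X"
  shows "x \<in> A \<longleftrightarrow> y \<in> A"
  using assms(1) by induction (auto simp: assms(2))

text \<open>A set that does not separate points lying in the same members of \<open>G\<close> is the
  union of the atoms of its points. As \<open>G\<close> is finite, each atom is a finite
  intersection and there are finitely many atoms.\<close>

lemma bool_closure_iff:
  assumes "finite G"
  shows "A \<in> bool_closure G \<longleftrightarrow>
    (\<forall>x y. (\<forall>X\<in>G. x \<in> X \<longleftrightarrow> y \<in> X) \<longrightarrow> (x \<in> A \<longleftrightarrow> y \<in> A))" (is "_ \<longleftrightarrow> ?sat")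
proof
  assume "A \<in> bool_closure G"
  then show ?sat using bool_closure_saturated[of A G] by blast
next
  assume sat: ?sat
  \<comment> \<open>For \<open>T \<subseteq> G\<close>, these are the points whose type, the set of
    members of \<open>G\<close> containing them, is exactly \<open>T\<close>.\<close>
  define atom where "atom T = \<Inter>(T \<union> uminus ` (G - T))" for T
  define type_of where "type_of x = {X \<in> G. x \<in> X}" for x
  have atom: "atom T \<in> bool_closure G" if "T \<subseteq> G" for T
    unfolding atom_def using assms that
    by (intro bool_closure_Inter) (auto intro: bool_closure.intros finite_subset)
  have "y \<in> atom (type_of x) \<longleftrightarrow> (\<forall>X\<in>G. x \<in> X \<longleftrightarrow> y \<in> X)" for x y
    by (auto simp: atom_def type_of_def)
  then have mem: "y \<in> \<Union>(atom ` type_of ` A) \<longleftrightarrow> (\<exists>x\<in>A. \<forall>X\<in>G. x \<in> X \<longleftrightarrow> y \<in> X)" for y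
    by simp
  have "A = \<Union>(atom ` type_of ` A)"
  proof (rule Set.set_eqI)
    fix y
    have "y \<in> A \<longleftrightarrow> (\<exists>x\<in>A. \<forall>X\<in>G. x \<in> X \<longleftrightarrow> y \<in> X)" using sat by metis
    then show "y \<in> A \<longleftrightarrow> y \<in> \<Union>(atom ` type_of ` A)" unfolding mem .
  qed
  moreover have "type_of ` A \<subseteq> Pow G" by (auto simp: type_of_def)
  then have "\<Union>(atom ` type_of ` A) \<in> bool_closure G"
    using assms atom by (intro bool_closure_Union) (auto intro: finite_subset)
  ultimately show "A \<in> bool_closure G" by simp
qed

lemma lattice_closure_upclosed:
  assumes "A \<in> lattice_closure G" "\<And>X. X \<in> G \<Longrightarrow> x \<in> X \<Longrightarrow> y \<in> X"
  shows "x \<in> A \<Longrightarrow> y \<in> A"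
  using assms(1) by induction (auto simp: assms(2))

text \<open>An up-closed set is the union of the least up-sets of its points, and the least up-set
  of \<open>x\<close> is the intersection of all members of \<open>G\<close> containing
  \<open>x\<close>. The closure admits such unions and intersections of any size.\<close>

lemma lattice_closure_iff:
  "A \<in> lattice_closure G \<longleftrightarrow> (\<forall>x y. (\<forall>X\<in>G. x \<in> X \<longrightarrow> y \<in> X) \<longrightarrow> x \<in> A \<longrightarrow> y \<in> A)" (is "_ \<longleftrightarrow> ?up")
proof
  assume "A \<in> lattice_closure G"
  then show ?up using lattice_closure_upclosed[of A G] by blast
next
  assume ?up
  then have "A = (\<Union>x\<in>A. \<Inter>{X \<in> G. x \<in> X})" by blast
  moreover have "(\<Union>x\<in>A. \<Inter>{X \<in> G. x \<in> X}) \<in> lattice_closure G"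
    by (intro lattice_closure.Union) (auto intro: lattice_closure.intros)
  ultimately show "A \<in> lattice_closure G" by simp
qed

section \<open>Runs of an nfa and of its reversal\<close>

lemma nfa_rel_subset: "is_nfa N \<Longrightarrow> nfa_rel N w \<subseteq> nfa_states N \<times> nfa_states N"
  by (induction w rule: rev_induct) (auto simp: nfa_rel_Nil nfa_rel_snoc is_nfa_def)

lemma nfa_rel_append: "is_nfa N \<Longrightarrow> nfa_rel N (u @ v) = nfa_rel N u O nfa_rel N v"
proof (induction v rule: rev_induct)
  case Nil
  \<comment> \<open>\<open>Id_on (nfa_states N)\<close> is a right unit only for relations whose
    range lies in the set of states.\<close>
  then show ?case using nfa_rel_subset[of N u] by (auto simp: nfa_rel_Nil)
next
  case (snoc a v)
  then show ?case by (simp add: nfa_rel_snoc O_assoc flip: append_assoc)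
qed

lemma nfa_rel_singleton: "is_nfa N \<Longrightarrow> nfa_rel N [a] = nfa_trans N a"
  using nfa_rel_snoc[of N "[]" a] by (fastforce simp: nfa_rel_Nil is_nfa_def)

text \<open>Converse reverses the order of composition. The induction peels off the first letter,
  since \<open>rev\<close> moves it to the end, where \<open>nfa_rel_snoc\<close> applies.\<close>

lemma nfa_rel_rev: "is_nfa N \<Longrightarrow> nfa_rel (nfa_rev N) (rev w) = (nfa_rel N w)\<inverse>"
proof (induction w)
  case Nil
  then show ?case by (auto simp: nfa_rel_Nil nfa_rev_def)
next
  case (Cons a w)
  have "nfa_rel N (a # w) = nfa_trans N a O nfa_rel N w"
    using nfa_rel_append[of N "[a]" w] Cons.prems by (simp add: nfa_rel_singleton)
  then show ?case
    using Cons by (simp add: nfa_rel_snoc converse_relcomp) (simp add: nfa_rev_def)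
qed

text \<open>The set \<open>S x\<close> of the overview. It transposes \<open>state_lang\<close>,
  turning conditions on all state languages into conditions on one set per word.\<close>

definition accepting :: "('a, 'q) nfa \<Rightarrow> 'a list \<Rightarrow> 'q set" where
  "accepting N x = {z \<in> nfa_states N. x \<in> state_lang N z}"

lemma nfa_rel_update_init: "nfa_rel (N\<lparr>nfa_init := J\<rparr>) w = nfa_rel N w"
  by (simp add: nfa_rel_def)

lemma mem_state_lang: "x \<in> state_lang N z \<longleftrightarrow> nfa_rel N x `` {z} \<inter> nfa_final N \<noteq> {}"
  by (simp add: state_lang_def nfa_lang_def nfa_rel_update_init)

lemma mem_accepting:
  assumes "is_nfa N"
  shows "z \<in> accepting N x \<longleftrightarrow> nfa_rel N x `` {z} \<inter> nfa_final N \<noteq> {}"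
  using nfa_rel_subset[OF assms, of x] by (auto simp: accepting_def mem_state_lang)

lemma mem_accepting_append:
  assumes "is_nfa N"
  shows "z \<in> accepting N (u @ x) \<longleftrightarrow> nfa_rel N u `` {z} \<inter> accepting N x \<noteq> {}"
  by (auto simp: nfa_rel_append[OF assms] mem_accepting[OF assms] disjoint_iff)

text \<open>Cutting an accepting run after \<open>u\<close> shows that acceptance depends on
  \<open>x\<close> only through \<open>accepting N x\<close>, and monotonically.\<close>

lemma append_mem_nfa_lang:
  assumes "is_nfa N"
  shows "u @ x \<in> nfa_lang N \<longleftrightarrow> nfa_rel N u `` nfa_init N \<inter> accepting N x \<noteq> {}"
  by (auto simp: nfa_lang_def nfa_rel_append[OF assms] mem_accepting[OF assms] disjoint_iff)

lemma mem_nfa_lang: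
  assumes "is_nfa N"
  shows "x \<in> nfa_lang N \<longleftrightarrow> nfa_init N \<inter> accepting N x \<noteq> {}"
  by (auto simp: nfa_lang_def mem_accepting[OF assms] disjoint_iff)

lemma reach_rev:
  assumes "is_nfa N"
  shows "nfa_rel (nfa_rev N) w `` nfa_init (nfa_rev N) = accepting N (rev w)"
  using nfa_rel_rev[OF assms, of "rev w"] by (auto simp: mem_accepting[OF assms] nfa_rev_def)

text \<open>A quotient by \<open>u\<close> depends only on the set of states that \<open>u\<close>
  reaches from the initial ones.\<close>

lemma finite_LW:
  assumes "is_nfa N"
  shows "finite (LW (nfa_lang N))"
proof (rule finite_surj)
  show "finite (Pow (nfa_states N))" using assms by (simp add: is_nfa_def)
  show "LW (nfa_lang N) \<subseteq> (\<lambda>T. {x. T \<inter> accepting N x \<noteq> {}}) ` Pow (nfa_states N)"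
  proof
    fix X assume "X \<in> LW (nfa_lang N)"
    then obtain u where "X = {x. nfa_rel N u `` nfa_init N \<inter> accepting N x \<noteq> {}}"
      by (auto simp: LW_def lquot_def append_mem_nfa_lang[OF assms])
    then show "X \<in> (\<lambda>T. {x. T \<inter> accepting N x \<noteq> {}}) ` Pow (nfa_states N)"
      using nfa_rel_subset[OF assms, of u] by blast
  qed
qed

text \<open>A two-sided quotient depends only on the states reached by the left word and the states
  accepting the right word.\<close>

lemma finite_lrquots:
  assumes "is_nfa N"
  shows "finite {lrquot u (nfa_lang N) v | u v. True}"
proof (rule finite_surj)
  let ?g = "\<lambda>(T, S). {w. nfa_rel N w `` T \<inter> S \<noteq> {}}"
  show "finite (Pow (nfa_states N) \<times> Pow (nfa_states N))" using assms by (simp add: is_nfa_def)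
  show "{lrquot u (nfa_lang N) v | u v. True} \<subseteq> ?g ` (Pow (nfa_states N) \<times> Pow (nfa_states N))"
  proof
    fix X assume "X \<in> {lrquot u (nfa_lang N) v | u v. True}"
    then obtain u v where X: "X = lrquot u (nfa_lang N) v" by blast
    have "u @ w @ v \<in> nfa_lang N \<longleftrightarrow> nfa_rel N w `` (nfa_rel N u `` nfa_init N) \<inter> accepting N v \<noteq> {}" for w
      using append_mem_nfa_lang[OF assms, of "u @ w" v]
      by (simp add: nfa_rel_append[OF assms] relcomp_Image)
    then have "X = ?g (nfa_rel N u `` nfa_init N, accepting N v)"
      by (simp add: X lrquot_def)
    moreover have "nfa_rel N u `` nfa_init N \<subseteq> nfa_states N" "accepting N v \<subseteq> nfa_states N"
      using nfa_rel_subset[OF assms, of u] by (auto simp: accepting_def)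
    ultimately show "X \<in> ?g ` (Pow (nfa_states N) \<times> Pow (nfa_states N))" by blast
  qed
qed

section \<open>Quotients of the reversed language\<close>

text \<open>The reversal of the right quotient of \<open>L\<close> by \<open>x\<close>, hence the
  left quotient of \<open>lang_rev L\<close> by \<open>rev x\<close>. Indexing by \<open>x\<close>
  matches \<open>accepting N x\<close>.\<close>

definition rquot_rev :: "'a list set \<Rightarrow> 'a list \<Rightarrow> 'a list set" where
  "rquot_rev L x = {v. rev v @ x \<in> L}"

lemma mem_lang_rev: "w \<in> lang_rev L \<longleftrightarrow> rev w \<in> L"
  by (auto simp: lang_rev_def image_iff intro: rev_rev_ident[symmetric])

lemma lquot_lang_rev: "lquot w (lang_rev L) = rquot_rev L (rev w)"
  by (simp add: lquot_def rquot_rev_def mem_lang_rev)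

lemma rquot_rev_Cons: "lquot [a] (rquot_rev L x) = rquot_rev L (a # x)"
  by (simp add: lquot_def rquot_rev_def)

lemma LW_lang_rev: "LW (lang_rev L) = range (rquot_rev L)"
proof
  show "range (rquot_rev L) \<subseteq> LW (lang_rev L)"
    using lquot_lang_rev[of "rev x" L for x] by (auto simp: LW_def)
qed (auto simp: LW_def lquot_lang_rev)

text \<open>Substituting \<open>u = rev v\<close> turns inclusion of these quotients into the
  preorder that \<open>LW L\<close> induces on words, the one in
  \<open>lattice_closure_iff\<close>.\<close>

lemma rquot_rev_subset_iff:
  "rquot_rev L x \<subseteq> rquot_rev L y \<longleftrightarrow> (\<forall>X\<in>LW L. x \<in> X \<longrightarrow> y \<in> X)"
proof -
  have "rquot_rev L x \<subseteq> rquot_rev L y \<longleftrightarrow> (\<forall>v. rev v @ x \<in> L \<longrightarrow> rev v @ y \<in> L)"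
    by (auto simp: rquot_rev_def)
  also have "\<dots> \<longleftrightarrow> (\<forall>u. u @ x \<in> L \<longrightarrow> u @ y \<in> L)"
    by (metis rev_rev_ident)
  also have "\<dots> \<longleftrightarrow> (\<forall>X\<in>LW L. x \<in> X \<longrightarrow> y \<in> X)"
    by (auto simp: LW_def lquot_def)
  finally show ?thesis .
qed

lemma rquot_rev_eq_iff:
  "rquot_rev L x = rquot_rev L y \<longleftrightarrow> (\<forall>X\<in>LW L. x \<in> X \<longleftrightarrow> y \<in> X)"
  unfolding set_eq_subset rquot_rev_subset_iff by blast

lemma rquot_rev_mono:
  assumes "is_nfa N" "accepting N x \<subseteq> accepting N y"
  shows "rquot_rev (nfa_lang N) x \<subseteq> rquot_rev (nfa_lang N) y"
  using assms(2) by (auto simp: rquot_rev_def append_mem_nfa_lang[OF assms(1)])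

section \<open>Isomorphisms from the reachable subsets of the reversal\<close>

lemma states_rsc_rev:
  assumes "is_nfa N"
  shows "dfa_states (rsc (nfa_rev N)) = range (accepting N)"
proof -
  have "dfa_states (rsc (nfa_rev N)) = range (\<lambda>w. accepting N (rev w))"
    by (auto simp: rsc_def reach_rev[OF assms])
  also have "\<dots> = range (accepting N)"
    by (metis surj_def rev_rev_ident image_image)
  finally show ?thesis .
qed

lemma init_rsc_rev:
  assumes "is_nfa N"
  shows "dfa_init (rsc (nfa_rev N)) = accepting N []"
  using reach_rev[OF assms, of "[]"] assms
  by (auto simp: rsc_def nfa_rev_def nfa_rel_Nil is_nfa_def)

lemma trans_rsc_rev:
  assumes "is_nfa N"
  shows "dfa_trans (rsc (nfa_rev N)) a (accepting N x) = accepting N (a # x)"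
  using mem_accepting_append[OF assms, of _ "[a]" x]
  by (auto simp: rsc_def nfa_rev_def nfa_rel_singleton[OF assms])

lemma final_rsc_rev:
  assumes "is_nfa N"
  shows "accepting N x \<in> dfa_final (rsc (nfa_rev N)) \<longleftrightarrow> x \<in> nfa_lang N"
proof -
  have "dfa_final (rsc (nfa_rev N)) = {X \<in> dfa_states (rsc (nfa_rev N)). X \<inter> nfa_init N \<noteq> {}}"
    by (auto simp: rsc_def nfa_rev_def)
  then show ?thesis
    by (auto simp: states_rsc_rev[OF assms] mem_nfa_lang[OF assms])
qed

text \<open>All states are reachable, so the initial state and the transitions force the values of
  an isomorphism. These values are onto and respect final states, which leaves injectivity.\<close>

lemma dfa_iso_rsc_rev_iff:
  assumes "is_nfa N"
  shows "dfa_iso f (rsc (nfa_rev N)) (dfa_of (lang_rev (nfa_lang N))) \<longleftrightarrow>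
    inj_on f (range (accepting N)) \<and> (\<forall>x. f (accepting N x) = rquot_rev (nfa_lang N) x)"
    (is "?iso \<longleftrightarrow> ?inj \<and> ?val")
proof
  assume iso: ?iso
  \<comment> \<open>Prepending a letter to \<open>x\<close> is one more transition on reading
    \<open>rev x\<close> from the initial state.\<close>
  have "f (accepting N x) = rquot_rev (nfa_lang N) x" for x
  proof (induction x)
    case Nil
    show ?case using iso lquot_lang_rev[of "[]" "nfa_lang N"]
      by (simp add: dfa_iso_def init_rsc_rev[OF assms] dfa_of_def lquot_def)
  next
    case (Cons a x)
    have "f (dfa_trans (rsc (nfa_rev N)) a (accepting N x)) = lquot [a] (f (accepting N x))"
      using iso by (auto simp: dfa_iso_def states_rsc_rev[OF assms] dfa_of_def)
    then show ?case by (simp add: trans_rsc_rev[OF assms] Cons rquot_rev_Cons)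
  qed
  then show "?inj \<and> ?val"
    using iso by (auto simp: dfa_iso_def states_rsc_rev[OF assms] bij_betw_def)
next
  assume *: "?inj \<and> ?val"
  have init: "rquot_rev (nfa_lang N) [] = lang_rev (nfa_lang N)"
    by (auto simp: rquot_rev_def mem_lang_rev)
  have final: "[] \<in> rquot_rev (nfa_lang N) x \<longleftrightarrow> x \<in> nfa_lang N" for x
    by (simp add: rquot_rev_def)
  from * show ?iso
    by (auto simp: dfa_iso_def states_rsc_rev[OF assms] init_rsc_rev[OF assms] bij_betw_def
        trans_rsc_rev[OF assms] final_rsc_rev[OF assms] dfa_of_def LW_lang_rev rquot_rev_Cons
        image_image init final)
qed

text \<open>The language that \<open>nfa_rev N\<close> accepts from the initial states
  \<open>X\<close>, written with runs of \<open>N\<close>. It is the witness for the isomorphism and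
  needs no choice of a word leading to \<open>X\<close>.\<close>

definition reach_map :: "('a, 'q) nfa \<Rightarrow> 'q set \<Rightarrow> 'a list set" where
  "reach_map N X = {v. nfa_rel N (rev v) `` nfa_init N \<inter> X \<noteq> {}}"

lemma reach_map_accepting:
  "is_nfa N \<Longrightarrow> reach_map N (accepting N x) = rquot_rev (nfa_lang N) x"
  by (simp add: reach_map_def rquot_rev_def append_mem_nfa_lang)

section \<open>Atomicity as conditions on accepting sets\<close>

text \<open>Equality of \<open>rquot_rev\<close> is the equivalence induced by the left quotients,
  and all state languages are saturated under it iff equivalent words have the same accepting
  states.\<close>

lemma atomic_iff:
  assumes "is_nfa N"
  shows "nfa_atomic N \<longleftrightarrow>
    (\<forall>x y. rquot_rev (nfa_lang N) x = rquot_rev (nfa_lang N) y \<longrightarrow> accepting N x = accepting N y)"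
  by (auto simp: nfa_atomic_def LP_def bool_closure_iff[OF finite_LW[OF assms]]
      rquot_rev_eq_iff accepting_def)

lemma positively_atomic_iff:
  assumes "is_nfa N"
  shows "nfa_positively_atomic N \<longleftrightarrow>
    (\<forall>x y. rquot_rev (nfa_lang N) x \<subseteq> rquot_rev (nfa_lang N) y \<longrightarrow> accepting N x \<subseteq> accepting N y)"
  by (auto simp: nfa_positively_atomic_def LD_def lattice_closure_iff
      rquot_rev_subset_iff accepting_def)

lemma subatomic_iff:
  assumes "is_nfa N"
  shows "nfa_subatomic N \<longleftrightarrow>
    (\<forall>x y. (x, y) \<in> syn_cong (nfa_lang N) \<longrightarrow> accepting N x = accepting N y)"
proof -
  have "(x, y) \<in> syn_cong L \<longleftrightarrow> (\<forall>X\<in>{lrquot u L v | u v. True}. x \<in> X \<longleftrightarrow> y \<in> X)"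
    for x y :: "'a list" and L
    by (auto simp: syn_cong_def lrquot_def)
  then show ?thesis
    unfolding nfa_subatomic_def LRP_def bool_closure_iff[OF finite_lrquots[OF assms]]
      accepting_def by blast
qed

section \<open>Transition monoid and syntactic monoid\<close>

lemma dfa_act_rsc_rev:
  assumes "is_nfa N"
  shows "dfa_act (rsc (nfa_rev N)) w (accepting N x) = accepting N (rev w @ x)"
  by (induction w rule: rev_induct)
    (auto simp: dfa_act_Nil dfa_act_snoc compose_def states_rsc_rev[OF assms]
      trans_rsc_rev[OF assms])

lemma dfa_act_extensional: "dfa_act A w \<in> extensional (dfa_states A)"
  by (cases w rule: rev_cases) (auto simp: dfa_act_Nil dfa_act_snoc)

lemma dfa_act_rsc_rev_eq_iff:
  assumes "is_nfa N"
  shows "dfa_act (rsc (nfa_rev N)) u = dfa_act (rsc (nfa_rev N)) v \<longleftrightarrow>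
    (\<forall>x. accepting N (rev u @ x) = accepting N (rev v @ x))"
proof
  assume "\<forall>x. accepting N (rev u @ x) = accepting N (rev v @ x)"
  then show "dfa_act (rsc (nfa_rev N)) u = dfa_act (rsc (nfa_rev N)) v"
    by (intro extensionalityI[OF dfa_act_extensional dfa_act_extensional])
      (auto simp: states_rsc_rev[OF assms] dfa_act_rsc_rev[OF assms])
qed (metis dfa_act_rsc_rev[OF assms])

lemma syn_cong_lang_rev:
  "(u, v) \<in> syn_cong (lang_rev L) \<longleftrightarrow> (rev u, rev v) \<in> syn_cong L"
  by (simp add: syn_cong_def mem_lang_rev) (metis rev_rev_ident)

lemma syn_class_eq_iff: "syn_class L u = syn_class L v \<longleftrightarrow> (u, v) \<in> syn_cong L"
  unfolding syn_class_def by (simp add: eq_equiv_class_iff[OF equiv_syn_cong])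

text \<open>Makes the map from actions to syntactic classes well defined: membership in any context
  depends only on the accepting sets after the left context.\<close>

lemma syn_cong_accepting:
  assumes "is_nfa N" "\<And>x. accepting N (u @ x) = accepting N (v @ x)"
  shows "(u, v) \<in> syn_cong (nfa_lang N)"
  by (auto simp: syn_cong_def append_mem_nfa_lang[OF assms(1)] assms(2))

lemma carrier_Syn: "carrier (Syn L) = range (syn_class L)"
  by (auto simp: Syn_def syn_class_def quotient_def)

text \<open>The syntactic congruence is stable under appending a word, so equality of accepting sets
  for congruent words extends to equality of actions on every state.\<close>

lemma subatomic_iff_dfa_act:
  assumes "is_nfa N"
  shows "nfa_subatomic N \<longleftrightarrow> (\<forall>u v. syn_class (lang_rev (nfa_lang N)) u = syn_class (lang_rev (nfa_lang N)) v
    \<longrightarrow> dfa_act (rsc (nfa_rev N)) u = dfa_act (rsc (nfa_rev N)) v)" (is "_ \<longleftrightarrow> ?faithful")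
  unfolding subatomic_iff[OF assms] syn_class_eq_iff syn_cong_lang_rev
    dfa_act_rsc_rev_eq_iff[OF assms]
proof (intro iffI allI impI)
  fix u v x
  assume *: "\<forall>x y. (x, y) \<in> syn_cong (nfa_lang N) \<longrightarrow> accepting N x = accepting N y"
    and "(rev u, rev v) \<in> syn_cong (nfa_lang N)"
  then have "(rev u @ x, rev v @ x) \<in> syn_cong (nfa_lang N)"
    by (auto intro: syn_cong_append simp: syn_cong_def)
  with * show "accepting N (rev u @ x) = accepting N (rev v @ x)" by blast
next
  fix x y
  assume "\<forall>u v. (rev u, rev v) \<in> syn_cong (nfa_lang N) \<longrightarrow>
      (\<forall>x. accepting N (rev u @ x) = accepting N (rev v @ x))"
    and "(x, y) \<in> syn_cong (nfa_lang N)"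
  \<comment> \<open>Take \<open>u = rev x\<close> and \<open>v = rev y\<close> and append the empty
    word, that is, compare the actions on the initial state.\<close>
  then show "accepting N x = accepting N y"
    by (metis append_Nil2 rev_rev_ident)
qed

text \<open>The prescribed values already make \<open>h\<close> a surjective homomorphism preserving
  the unit, so only injectivity is in question.\<close>

lemma monoid_iso_TM_Syn_iff:
  assumes closed: "\<And>a q. q \<in> dfa_states A \<Longrightarrow> dfa_trans A a q \<in> dfa_states A"
    and h: "\<And>w. h (dfa_act A w) = syn_class L w"
  shows "monoid_iso h (TM A) (Syn L) \<longleftrightarrow>
    (\<forall>u v. syn_class L u = syn_class L v \<longrightarrow> dfa_act A u = dfa_act A v)"
proof -
  have c: "carrier (TM A) = range (dfa_act A)" and one: "\<one>\<^bsub>TM A\<^esub> = dfa_act A []"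
    by (simp_all add: TM_def dfa_act_Nil)
  have "h \<in> hom (TM A) (Syn L)"
    by (auto simp: hom_def c carrier_Syn TM_mult[OF closed] h Syn_mult)
  moreover have "h \<one>\<^bsub>TM A\<^esub> = \<one>\<^bsub>Syn L\<^esub>" unfolding one by (simp add: h Syn_def)
  moreover have "h ` carrier (TM A) = carrier (Syn L)"
    by (simp add: c carrier_Syn image_image h)
  moreover have "inj_on h (carrier (TM A)) \<longleftrightarrow>
      (\<forall>u v. syn_class L u = syn_class L v \<longrightarrow> dfa_act A u = dfa_act A v)"
    by (auto simp: inj_on_def c h)
  ultimately show ?thesis
    by (auto simp: monoid_iso_def iso_def bij_betw_def)
qed

theorem theorem4p6p6:
  fixes N :: "('a, 'q) nfa" and L :: "'a list set"
  assumes "is_nfa N" and "nfa_lang N = L"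
  shows "(nfa_atomic N \<longleftrightarrow> (\<exists>f. dfa_iso f (rsc (nfa_rev N)) (dfa_of (lang_rev L))))
    \<and> (nfa_positively_atomic N \<longleftrightarrow>
         (\<exists>f. dfa_iso f (rsc (nfa_rev N)) (dfa_of (lang_rev L)) \<and>
              (\<forall>X\<in>dfa_states (rsc (nfa_rev N)). \<forall>Y\<in>dfa_states (rsc (nfa_rev N)).
                 X \<subseteq> Y \<longleftrightarrow> f X \<subseteq> f Y)))
    \<and> (nfa_subatomic N \<longleftrightarrow>
         (\<exists>h. (\<forall>w. h (dfa_act (rsc (nfa_rev N)) w) = syn_class (lang_rev L) w) \<and>
              monoid_iso h (TM (rsc (nfa_rev N))) (Syn (lang_rev L))))"
proof (intro conjI)
  note nfa = assms(1)
  have L: "L = nfa_lang N" using assms(2) by simp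
  note iso = dfa_iso_rsc_rev_iff[OF nfa] and map = reach_map_accepting[OF nfa]
  note states = states_rsc_rev[OF nfa]
  show "nfa_atomic N \<longleftrightarrow> (\<exists>f. dfa_iso f (rsc (nfa_rev N)) (dfa_of (lang_rev L)))"
  proof
    assume "nfa_atomic N"
    then have "inj_on (reach_map N) (range (accepting N))"
      unfolding atomic_iff[OF nfa] by (intro inj_onI) (metis map rangeE)
    then show "\<exists>f. dfa_iso f (rsc (nfa_rev N)) (dfa_of (lang_rev L))"
      unfolding L iso using map by blast
  next
    assume "\<exists>f. dfa_iso f (rsc (nfa_rev N)) (dfa_of (lang_rev L))"
    then obtain f where "inj_on f (range (accepting N))"
      "\<And>x. f (accepting N x) = rquot_rev (nfa_lang N) x"
      unfolding L iso by blast
    then show "nfa_atomic N"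
      unfolding atomic_iff[OF nfa] by (metis inj_onD rangeI)
  qed
  show "nfa_positively_atomic N \<longleftrightarrow>
         (\<exists>f. dfa_iso f (rsc (nfa_rev N)) (dfa_of (lang_rev L)) \<and>
              (\<forall>X\<in>dfa_states (rsc (nfa_rev N)). \<forall>Y\<in>dfa_states (rsc (nfa_rev N)).
                 X \<subseteq> Y \<longleftrightarrow> f X \<subseteq> f Y))"
  proof
    assume "nfa_positively_atomic N"
    \<comment> \<open>The forward direction is monotonicity, valid for every nfa; positive atomicity
      supplies the converse.\<close>
    then have order: "accepting N x \<subseteq> accepting N y \<longleftrightarrow>
        reach_map N (accepting N x) \<subseteq> reach_map N (accepting N y)" for x y
      using rquot_rev_mono[OF nfa, of x y] by (auto simp: positively_atomic_iff[OF nfa] map)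
    then have "inj_on (reach_map N) (range (accepting N))"
      by (intro inj_onI) (metis order_antisym order_refl rangeE)
    with map order show "\<exists>f. dfa_iso f (rsc (nfa_rev N)) (dfa_of (lang_rev L)) \<and>
        (\<forall>X\<in>dfa_states (rsc (nfa_rev N)). \<forall>Y\<in>dfa_states (rsc (nfa_rev N)).
           X \<subseteq> Y \<longleftrightarrow> f X \<subseteq> f Y)"
      unfolding L iso states by blast
  next
    assume "\<exists>f. dfa_iso f (rsc (nfa_rev N)) (dfa_of (lang_rev L)) \<and>
        (\<forall>X\<in>dfa_states (rsc (nfa_rev N)). \<forall>Y\<in>dfa_states (rsc (nfa_rev N)).
           X \<subseteq> Y \<longleftrightarrow> f X \<subseteq> f Y)"
    then show "nfa_positively_atomic N"
      unfolding L iso states positively_atomic_iff[OF nfa] by (metis rangeI)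
  qed
  let ?A = "rsc (nfa_rev N)"
  note monoid_iso = monoid_iso_TM_Syn_iff[of ?A, OF rsc_trans_closed]
  show "nfa_subatomic N \<longleftrightarrow>
         (\<exists>h. (\<forall>w. h (dfa_act ?A w) = syn_class (lang_rev L) w) \<and>
              monoid_iso h (TM ?A) (Syn (lang_rev L)))"
  proof
    assume sub: "nfa_subatomic N"
    \<comment> \<open>Any word with the action \<open>g\<close> serves as representative;
      \<open>syn_cong_accepting\<close> makes the class independent of the choice.\<close>
    define h where "h g = syn_class (lang_rev L) (SOME w. dfa_act ?A w = g)" for g
    have h: "h (dfa_act ?A w) = syn_class (lang_rev L) w" for w
    proof -
      have "dfa_act ?A (SOME v. dfa_act ?A v = dfa_act ?A w) = dfa_act ?A w"
        by (rule someI) simp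
      then show ?thesis
        unfolding h_def syn_class_eq_iff syn_cong_lang_rev dfa_act_rsc_rev_eq_iff[OF nfa] L
        by (intro syn_cong_accepting[OF nfa]) simp
    qed
    then have "monoid_iso h (TM ?A) (Syn (lang_rev L))"
      using sub monoid_iso[of h "lang_rev L", OF _ h] unfolding L subatomic_iff_dfa_act[OF nfa]
      by blast
    with h show "\<exists>h. (\<forall>w. h (dfa_act ?A w) = syn_class (lang_rev L) w) \<and>
        monoid_iso h (TM ?A) (Syn (lang_rev L))" by blast
  next
    assume "\<exists>h. (\<forall>w. h (dfa_act ?A w) = syn_class (lang_rev L) w) \<and>
        monoid_iso h (TM ?A) (Syn (lang_rev L))"
    then show "nfa_subatomic N"
      unfolding L subatomic_iff_dfa_act[OF nfa] using monoid_iso by blast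
  qed
qed

end
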